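(* Let $G$ be a finite simple $r$-regular graph with $r \geq 2$, and let $p$ be a non-negative integer. Then \[ \alpha_p(G) \leq \alpha_p(L(G)). \]
   Context: For a graph $G$ and a non-negative integer $p$, a set $S \subseteq V(G)$ is $p$-independent if the subgraph induced by $S$ has maximum degree at most $p$; $\alpha_p(G)$ denotes the maximum cardinality of a $p$-independent set of $G$. $L(G)$ is the line graph of $G$: its vertex set is $E(G)$, two vertices being adjacent iff the corresponding edges share an endpoint. *)

theory Defs
  imports Main
begin

record 'a graph =
  verts :: "'a set"
  edges :: "'a set set"

definition finite_simple_graph :: "'a graph \<Rightarrow> bool" where
  "finite_simple_graph G \<longleftrightarrow> finite (verts G) \<and> (\<forall>e\<in>edges G. e \<subseteq> verts G \<and> card e = 2)"

definition adjacent :: "'a graph \<Rightarrow> 'a \<Rightarrow> 'a \<Rightarrow> bool" where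
  "adjacent G u v \<longleftrightarrow> {u, v} \<in> edges G"

definition degree :: "'a graph \<Rightarrow> 'a \<Rightarrow> nat" where
  "degree G v = card {u \<in> verts G. adjacent G v u}"

definition regular :: "nat \<Rightarrow> 'a graph \<Rightarrow> bool" where
  "regular r G \<longleftrightarrow> (\<forall>v\<in>verts G. degree G v = r)"

text \<open>Inserting 0 gives the graph without vertices maximum degree 0, so that the empty
  set is \<open>p\<close>-independent for every \<open>p\<close>; it changes nothing for other finite graphs.\<close>

definition max_degree :: "'a graph \<Rightarrow> nat" where
  "max_degree G = Max (insert 0 (degree G ` verts G))"

definition induced_subgraph :: "'a graph \<Rightarrow> 'a set \<Rightarrow> 'a graph" where
  "induced_subgraph G S = \<lparr>verts = S, edges = {e \<in> edges G. e \<subseteq> S}\<rparr>"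

definition p_independent :: "nat \<Rightarrow> 'a graph \<Rightarrow> 'a set \<Rightarrow> bool" where
  "p_independent p G S \<longleftrightarrow> S \<subseteq> verts G \<and> max_degree (induced_subgraph G S) \<le> p"

text \<open>For finite \<open>G\<close>, the set of cardinalities is finite and contains 0.\<close>

definition alpha :: "nat \<Rightarrow> 'a graph \<Rightarrow> nat" where
  "alpha p G = Max {card S | S. p_independent p G S}"

text \<open>A vertex of the line graph is an edge of \<open>G\<close>, itself a set of vertices of \<open>G\<close>. Distinctness
  of \<open>e\<close> and \<open>f\<close> excludes loops.\<close>

definition line_graph :: "'a graph \<Rightarrow> 'a set graph" where
  "line_graph G = \<lparr>verts = edges G,
     edges = {{e, f} | e f. e \<in> edges G \<and> f \<in> edges G \<and> e \<noteq> f \<and> e \<inter> f \<noteq> {}}\<rparr>"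

end

theory Submission
  imports Defs
begin

text \<open>Let \<open>n\<close> be the number of vertices and \<open>S\<close> a largest \<open>p\<close>-independent set.

  If \<open>p < r\<close>, each vertex of \<open>S\<close> has at least \<open>r - p\<close> neighbours outside \<open>S\<close>, and each vertex outside
  \<open>S\<close> has at most \<open>r\<close> neighbours in \<open>S\<close>. As \<open>r \<le> (p + 1) (r - p)\<close>, Hall's theorem assigns to each
  vertex of \<open>S\<close> a neighbour outside \<open>S\<close> such that none is used more than \<open>p + 1\<close> times. The
  \<open>card S\<close> edges used form stars with at most \<open>p + 1\<close> edges each.

  If \<open>p \<ge> r\<close>, it suffices to find \<open>n\<close> edges such that the degrees \<open>d\<close> in the subgraph they form
  satisfy \<open>d u + d v \<le> r + 2\<close> for each of its edges \<open>uv\<close>. Starting from all edges, delete edges that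
  violate this inequality. A deletion does not decrease the sum of \<open>(d v - 2) (r - d v)\<close> over the
  vertices, which is \<open>0\<close> initially, so it is nonnegative at the end. Since
  \<open>(d - 2) (r - d) \<le> (r - 2) (d - 2)\<close>, the final average degree is at least 2 if \<open>r > 2\<close>; if \<open>r = 2\<close>,
  the sum is that of \<open>- (d v - 2)\<^sup>2\<close>, so all degrees are 2.\<close>

section \<open>Hall's marriage theorem\<close>

text \<open>Induction on \<open>card I\<close>. If every nonempty proper subfamily has a surplus,
  any choice for a single index preserves Hall's condition for the rest. Otherwise some nonempty
  proper subfamily \<open>J\<close> is tight, and \<open>J\<close> and \<open>I - J\<close> are
  matched separately, the latter outside \<open>B\<close>.\<close>

theorem hall:
  fixes A :: "'i \<Rightarrow> 'b set"
  assumes "finite I" and "\<And>i. i \<in> I \<Longrightarrow> finite (A i)"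
    and "\<And>J. J \<subseteq> I \<Longrightarrow> card J \<le> card (\<Union>(A ` J))"
  shows "\<exists>f. inj_on f I \<and> (\<forall>i\<in>I. f i \<in> A i)"
  using assms
proof (induction "card I" arbitrary: I A rule: less_induct)
  case less
  show ?case
  proof (cases "I = {}")
    case True
    then show ?thesis by simp
  next
    case False
    then obtain i where i: "i \<in> I" by blast
    show ?thesis
    proof (cases "\<exists>J. J \<subset> I \<and> J \<noteq> {} \<and> card (\<Union>(A ` J)) \<le> card J")
      case False
      then have strict: "card J < card (\<Union>(A ` J))" if "J \<subset> I" "J \<noteq> {}" for J
        using that by (meson not_le)
      have "card {i} \<le> card (\<Union>(A ` {i}))" using less.prems(3)[of "{i}"] i by blast
      then obtain x where x: "x \<in> A i" by fastforce
      have "\<exists>f. inj_on f (I - {i}) \<and> (\<forall>j\<in>I - {i}. f j \<in> A j - {x})"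
      proof (rule less.hyps)
        show "card (I - {i}) < card I" using i less.prems(1) by (meson card_Diff1_less)
        fix J assume J: "J \<subseteq> I - {i}"
        have eq: "(\<Union>j\<in>J. A j - {x}) = \<Union>(A ` J) - {x}" by blast
        show "card J \<le> card (\<Union>j\<in>J. A j - {x})"
        proof (cases "J = {}")
          case False
          \<comment> \<open>The surplus of one element makes up for the loss of
            \<open>x\<close>.\<close>
          have "card J < card (\<Union>(A ` J))" using strict[of J] J i False by blast
          then show ?thesis unfolding eq by (auto simp: card_Diff_singleton_if)
        qed simp
      qed (use less.prems(1,2) in auto)
      then obtain f where f: "inj_on f (I - {i})" "\<And>j. j \<in> I - {i} \<Longrightarrow> f j \<in> A j - {x}" by blast
      have "inj_on (f(i := x)) I"
        using f by (auto simp: inj_on_def)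
      moreover have "\<forall>j\<in>I. (f(i := x)) j \<in> A j" using f x by auto
      ultimately show ?thesis by blast
    next
      case True
      then obtain J where J: "J \<subset> I" "J \<noteq> {}" and tight: "card (\<Union>(A ` J)) \<le> card J" by blast
      have finJ: "finite J" using J less.prems(1) finite_subset by blast
      define B where "B = \<Union>(A ` J)"
      have finB: "finite B" unfolding B_def using finJ J less.prems(2) by blast
      have "\<exists>f. inj_on f J \<and> (\<forall>j\<in>J. f j \<in> A j)"
      proof (rule less.hyps)
        show "card J < card I" using J less.prems(1) by (simp add: psubset_card_mono)
        show "card K \<le> card (\<Union>(A ` K))" if "K \<subseteq> J" for K
          using that J by (intro less.prems(3)) auto
      qed (use finJ J less.prems(2) in auto)
      then obtain f where f: "inj_on f J" "\<And>j. j \<in> J \<Longrightarrow> f j \<in> A j" by blast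
      have "\<exists>g. inj_on g (I - J) \<and> (\<forall>j\<in>I - J. g j \<in> A j - B)"
      proof (rule less.hyps)
        show "card (I - J) < card I" using J less.prems(1) by (intro psubset_card_mono) auto
        fix K assume K: "K \<subseteq> I - J"
        have finK: "finite K" using K less.prems(1) finite_subset by blast
        \<comment> \<open>Hall's condition for \<open>K \<union> J\<close>, less the at most
          \<open>card J\<close> elements of the tight union \<open>B\<close>, leaves enough elements
          for \<open>K\<close>.\<close>
        have "card K + card J = card (K \<union> J)"
          using K finK finJ by (subst card_Un_disjoint) auto
        also have "\<dots> \<le> card (\<Union>(A ` (K \<union> J)))" using K J by (intro less.prems(3)) auto
        also have "\<Union>(A ` (K \<union> J)) = (\<Union>j\<in>K. A j - B) \<union> B" unfolding B_def by blast
        also have "card \<dots> \<le> card (\<Union>j\<in>K. A j - B) + card B" by (rule card_Un_le)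
        finally show "card K \<le> card (\<Union>j\<in>K. A j - B)" using tight B_def by simp
      qed (use less.prems(1,2) in auto)
      then obtain g where g: "inj_on g (I - J)" "\<And>j. j \<in> I - J \<Longrightarrow> g j \<in> A j - B" by blast
      define h where "h j = (if j \<in> J then f j else g j)" for j
      have fB: "f j \<in> B" if "j \<in> J" for j using f that B_def by blast
      have "inj_on h I"
      proof (rule inj_onI)
        fix x y assume "x \<in> I" "y \<in> I" "h x = h y"
        \<comment> \<open>Membership in \<open>B\<close> separates the values of \<open>f\<close>
          from those of \<open>g\<close>, so the two injections never collide.\<close>
        moreover have "h j \<in> B \<longleftrightarrow> j \<in> J" if "j \<in> I" for j
          using that fB g(2)[of j] by (simp add: h_def)
        ultimately have "x \<in> J \<longleftrightarrow> y \<in> J" by metis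
        then show "x = y" using \<open>h x = h y\<close> \<open>x \<in> I\<close> \<open>y \<in> I\<close> f(1) g(1)
          by (cases "x \<in> J") (auto simp: h_def dest: inj_onD)
      qed
      moreover have "\<forall>j\<in>I. h j \<in> A j" using f g h_def by auto
      ultimately show ?thesis by blast
    qed
  qed
qed

section \<open>Independence in the line graph and incidence counts\<close>

lemma p_independent_iff:
  assumes "finite S"
  shows "p_independent p G S \<longleftrightarrow>
    S \<subseteq> verts G \<and> (\<forall>v\<in>S. card {u \<in> S. {v, u} \<in> edges G} \<le> p)"
proof -
  have "degree (induced_subgraph G S) v = card {u \<in> S. {v, u} \<in> edges G}" if "v \<in> S" for v
    using that unfolding degree_def adjacent_def induced_subgraph_def
    by (intro arg_cong[where f = card]) auto
  then show ?thesis
    using assms by (auto simp: p_independent_def max_degree_def induced_subgraph_def)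
qed

lemma
  assumes "finite (verts G)"
  shows card_le_alpha: "p_independent p G S \<Longrightarrow> card S \<le> alpha p G"
    and alpha_attained: "\<exists>S. p_independent p G S \<and> card S = alpha p G"
proof -
  have sub: "{card S | S. p_independent p G S} \<subseteq> card ` Pow (verts G)"
    by (auto simp: p_independent_def)
  then have fin: "finite {card S | S. p_independent p G S}"
    using assms finite_subset by blast
  show "p_independent p G S \<Longrightarrow> card S \<le> alpha p G"
    unfolding alpha_def by (rule Max_ge[OF fin]) blast
  have "p_independent p G {}" by (simp add: p_independent_iff)
  then have "{card S | S. p_independent p G S} \<noteq> {}" by blast
  from Max_in[OF fin this] show "\<exists>S. p_independent p G S \<and> card S = alpha p G"
    unfolding alpha_def by auto
qed

lemma finite_edges: "finite_simple_graph G \<Longrightarrow> finite (edges G)"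
  unfolding finite_simple_graph_def by (meson PowI finite_Pow_iff finite_subset subsetI)

text \<open>Reduces independence in the line graph to counting, for each chosen edge, the other
  chosen edges that meet it; both cases of the proof supply this count.\<close>

lemma p_independent_line_graph:
  assumes "finite F" "F \<subseteq> edges G"
    and "\<And>e. e \<in> F \<Longrightarrow> card {f \<in> F. f \<noteq> e \<and> e \<inter> f \<noteq> {}} \<le> p"
  shows "p_independent p (line_graph G) F"
proof -
  have "{f \<in> F. {e, f} \<in> edges (line_graph G)} = {f \<in> F. f \<noteq> e \<and> e \<inter> f \<noteq> {}}" if "e \<in> F" for e
    using that assms(2) by (auto simp: line_graph_def doubleton_eq_iff)
  then show ?thesis
    using assms by (auto simp: p_independent_iff line_graph_def)
qed

lemma degree_eq_card_incident_edges:
  assumes "finite_simple_graph G"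
  shows "degree G v = card {e \<in> edges G. v \<in> e}"
proof -
  have "bij_betw (\<lambda>u. {v, u}) {u \<in> verts G. adjacent G v u} {e \<in> edges G. v \<in> e}"
  proof (rule bij_betw_imageI)
    show "inj_on (\<lambda>u. {v, u}) {u \<in> verts G. adjacent G v u}"
      by (auto simp: inj_on_def doubleton_eq_iff)
    have "e \<in> (\<lambda>u. {v, u}) ` {u \<in> verts G. adjacent G v u}" if "e \<in> edges G" "v \<in> e" for e
    proof -
      have "card e = 2" "e \<subseteq> verts G" using assms that by (auto simp: finite_simple_graph_def)
      then obtain x y where "e = {x, y}" by (auto simp: card_2_iff)
      then have "e = {v, x} \<or> e = {v, y}" using that by auto
      then obtain u where "e = {v, u}" by blast
      then show ?thesis using that \<open>e \<subseteq> verts G\<close> by (auto simp: adjacent_def)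
    qed
    then show "(\<lambda>u. {v, u}) ` {u \<in> verts G. adjacent G v u} = {e \<in> edges G. v \<in> e}"
      by (auto simp: adjacent_def)
  qed
  then show ?thesis unfolding degree_def by (rule bij_betw_same_card)
qed

text \<open>Double counting of incidences. \<open>F\<close> is arbitrary because the use is for a
  thinned edge set rather than for \<open>edges G\<close>.\<close>

lemma sum_card_incident_edges:
  assumes "finite V" "finite F" "\<And>e. e \<in> F \<Longrightarrow> e \<subseteq> V \<and> card e = 2"
  shows "(\<Sum>v\<in>V. card {e \<in> F. v \<in> e}) = 2 * card F"
proof -
  have "(\<Sum>v\<in>V. card {e \<in> F. v \<in> e}) = (\<Sum>e\<in>F. card {v \<in> V. v \<in> e})"
    using sum.swap_restrict[OF assms(1,2), of "\<lambda>_ _. 1::nat" "(\<in>)"] by simp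
  also have "\<dots> = (\<Sum>e\<in>F. 2)"
  proof (rule sum.cong)
    fix e assume "e \<in> F"
    moreover from this have "{v \<in> V. v \<in> e} = e" using assms(3) by blast
    ultimately show "card {v \<in> V. v \<in> e} = 2" using assms(3) by simp
  qed simp
  finally show ?thesis by simp
qed

section \<open>Dense edge sets, for \<open>p \<ge> r\<close>\<close>

lemma exists_dense_edge_set:
  assumes G: "finite_simple_graph G" and reg: "regular r G" and r: "r \<ge> 2"
  obtains F where "F \<subseteq> edges G" "card (verts G) \<le> card F"
    "\<forall>u v. {u, v} \<in> F \<longrightarrow> card {e \<in> F. u \<in> e} + card {e \<in> F. v \<in> e} \<le> r + 2"
proof -
  define V where "V = verts G"
  \<comment> \<open>Integers, since \<open>h\<close> is negative at degrees 0 and 1, where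
    subtraction on naturals would truncate.\<close>
  define d where "d F v = int (card {e \<in> F. v \<in> e})" for F :: "'a set set" and v
  define h where "h x = (x - 2) * (int r - x)" for x
  have E: "e \<subseteq> V" "card e = 2" if "e \<in> edges G" for e
    using G that by (auto simp: V_def finite_simple_graph_def)
  have V: "finite V" using G by (auto simp: V_def finite_simple_graph_def)
  have finE: "finite (edges G)" using G by (rule finite_edges)
  have "(\<Sum>v\<in>V. h (d (edges G) v)) = 0"
    using reg degree_eq_card_incident_edges[OF G]
    by (intro sum.neutral) (auto simp: regular_def h_def d_def V_def)
  define P where "P F \<longleftrightarrow> F \<subseteq> edges G \<and> 0 \<le> (\<Sum>v\<in>V. h (d F v))" for F
  have "P (edges G)" using \<open>(\<Sum>v\<in>V. h (d (edges G) v)) = 0\<close> by (simp add: P_def)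
  \<comment> \<open>A set of least cardinality with nonnegative sum replaces the deletion process:
    deleting a violating edge would give a smaller such set.\<close>
  then obtain F where "P F" and min: "\<And>F'. P F' \<Longrightarrow> card F \<le> card F'"
    using ex_has_least_nat[of P "edges G" card] by blast
  then have F: "F \<subseteq> edges G" and pos: "0 \<le> (\<Sum>v\<in>V. h (d F v))" by (simp_all add: P_def)
  have finF: "finite F" using F finE finite_subset by blast
  have deg: "card {e \<in> F. u \<in> e} + card {e \<in> F. v \<in> e} \<le> r + 2" if uv: "{u, v} \<in> F" for u v
  proof (rule ccontr)
    assume "\<not> ?thesis"
    then have large: "d F u + d F v \<ge> int r + 3" by (simp add: d_def)
    have "u \<noteq> v" using E(2)[of "{u, v}"] uv F by auto
    have uvV: "u \<in> V" "v \<in> V" using E(1) uv F by blast+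
    define F' where "F' = F - {{u, v}}"
    have d': "d F' w = d F w - (if w = u \<or> w = v then 1 else 0)" for w
    proof -
      have "{e \<in> F'. w \<in> e} = {e \<in> F. w \<in> e} - (if w = u \<or> w = v then {{u, v}} else {})"
        unfolding F'_def by auto
      moreover have "card {e \<in> F. w \<in> e} \<ge> 1" if "w = u \<or> w = v"
      proof -
        have "{u, v} \<in> {e \<in> F. w \<in> e}" using that uv by blast
        then have "card {e \<in> F. w \<in> e} > 0" using finF by (auto simp: card_gt_0_iff)
        then show ?thesis by simp
      qed
      ultimately show ?thesis using uv finF by (auto simp: d_def)
    qed
    have split: "(\<Sum>w\<in>V. h (x w)) = h (x u) + h (x v) + (\<Sum>w\<in>V - {u, v}. h (x w))" for x
    proof -
      have "V - {u} - {v} = V - {u, v}" by blast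
      then show ?thesis
        using sum.remove[of V u "\<lambda>w. h (x w)"] sum.remove[of "V - {u}" v "\<lambda>w. h (x w)"]
          uvV \<open>u \<noteq> v\<close> V by simp
    qed
    \<comment> \<open>As \<open>h (x - 1) - h x = 2 * x - r - 3\<close>, the total change at
      \<open>u\<close> and \<open>v\<close> is nonnegative exactly when their degrees in
      \<open>F\<close> sum to at least \<open>r + 3\<close>.\<close>
    have "h (d F' u) + h (d F' v) \<ge> h (d F u) + h (d F v)"
      using large by (simp add: d' h_def algebra_simps)
    moreover have "(\<Sum>w\<in>V - {u, v}. h (d F' w)) = (\<Sum>w\<in>V - {u, v}. h (d F w))"
      by (intro sum.cong) (auto simp: d')
    ultimately have "0 \<le> (\<Sum>w\<in>V. h (d F' w))" using pos unfolding split by linarith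
    then have "P F'" using F by (auto simp: P_def F'_def)
    then have "card F \<le> card F'" by (rule min)
    moreover have "card F' < card F" unfolding F'_def using uv finF by (rule card_Diff1_less[rotated])
    ultimately show False by simp
  qed
  have "0 \<le> (\<Sum>v\<in>V. d F v - 2)"
  \<comment> \<open>The linear bound used for \<open>r > 2\<close> has the factor
    \<open>r - 2\<close>, which must be positive to be cancelled.\<close>
  proof (cases "r = 2")
    case True
    have "(\<Sum>v\<in>V. (d F v - 2)\<^sup>2) \<le> 0"
    proof -
      have "h x = - ((x - 2)\<^sup>2)" for x
        using True by (simp add: h_def power2_eq_square algebra_simps)
      then show ?thesis using pos by (simp add: sum_negf)
    qed
    then have "\<forall>v\<in>V. (d F v - 2)\<^sup>2 = 0"
      using V by (subst sum_nonneg_eq_0_iff[symmetric]) (auto intro!: antisym sum_nonneg)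
    then show ?thesis by simp
  next
    case False
    have "h x \<le> (int r - 2) * (x - 2)" for x
    proof -
      have "(int r - 2) * (x - 2) - h x = (x - 2)\<^sup>2" by (simp add: h_def power2_eq_square algebra_simps)
      then show ?thesis by (metis diff_ge_0_iff_ge zero_le_power2)
    qed
    then have "(\<Sum>v\<in>V. h (d F v)) \<le> (\<Sum>v\<in>V. (int r - 2) * (d F v - 2))" by (intro sum_mono)
    then have "0 \<le> (int r - 2) * (\<Sum>v\<in>V. d F v - 2)" using pos by (simp add: sum_distrib_left)
    then show ?thesis using False r by (simp add: zero_le_mult_iff)
  qed
  also have "\<dots> = int (\<Sum>v\<in>V. card {e \<in> F. v \<in> e}) - 2 * int (card V)"
    by (simp add: sum_subtractf d_def)
  also have "(\<Sum>v\<in>V. card {e \<in> F. v \<in> e}) = 2 * card F"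
    using V finF E F by (intro sum_card_incident_edges) blast+
  finally have "card V \<le> card F" by simp
  then show thesis using that F deg V_def by blast
qed

lemma card_verts_le_alpha_line_graph:
  assumes G: "finite_simple_graph G" and reg: "regular r G" and r: "r \<ge> 2" and p: "r \<le> p"
  shows "card (verts G) \<le> alpha p (line_graph G)"
proof -
  obtain F where F: "F \<subseteq> edges G" "card (verts G) \<le> card F"
    and deg: "\<forall>u v. {u, v} \<in> F \<longrightarrow> card {e \<in> F. u \<in> e} + card {e \<in> F. v \<in> e} \<le> r + 2"
    using exists_dense_edge_set[OF G reg r] by blast
  have finE: "finite (edges G)" using G by (rule finite_edges)
  then have finF: "finite F" using F finite_subset by blast
  have "card {f \<in> F. f \<noteq> e \<and> e \<inter> f \<noteq> {}} \<le> p" if e: "e \<in> F" for e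
  proof -
    have "card e = 2" using G e F by (auto simp: finite_simple_graph_def)
    then obtain u v where uv: "e = {u, v}" by (auto simp: card_2_iff)
    let ?D = "\<lambda>w. {f \<in> F. w \<in> f}"
    \<comment> \<open>The edge \<open>e\<close> is counted at both of its ends; removing it twice
      turns the bound \<open>r + 2\<close> into \<open>r\<close>.\<close>
    have "card {f \<in> F. f \<noteq> e \<and> e \<inter> f \<noteq> {}} \<le> card ((?D u - {e}) \<union> (?D v - {e}))"
      using finF uv by (intro card_mono) auto
    also have "\<dots> \<le> card (?D u - {e}) + card (?D v - {e})" by (rule card_Un_le)
    also have "\<dots> = (card (?D u) - 1) + (card (?D v) - 1)" using e uv finF by simp
    also have "\<dots> \<le> p"
    proof -
      \<comment> \<open>Both counts include \<open>e\<close>, so neither subtraction of 1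
        truncates.\<close>
      have "card (?D u) > 0" "card (?D v) > 0" using e uv finF by (auto simp: card_gt_0_iff)
      then show ?thesis using deg e uv p by fastforce
    qed
    finally show ?thesis .
  qed
  then have "p_independent p (line_graph G) F"
    using p_independent_line_graph[OF finF F(1)] by blast
  then have "card F \<le> alpha p (line_graph G)"
    using finE by (intro card_le_alpha) (auto simp: line_graph_def)
  then show ?thesis using F by simp
qed

section \<open>Stars from Hall's theorem, for \<open>p < r\<close>\<close>

lemma card_p_independent_le_alpha_line_graph:
  assumes G: "finite_simple_graph G" and reg: "regular r G" and p: "p < r"
    and S: "p_independent p G S"
  shows "card S \<le> alpha p (line_graph G)"
proof -
  have finV: "finite (verts G)" using G by (simp add: finite_simple_graph_def)
  have finS: "finite S" using S finV finite_subset by (auto simp: p_independent_def)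
  have SV: "S \<subseteq> verts G" and Sdeg: "\<And>v. v \<in> S \<Longrightarrow> card {u \<in> S. {v, u} \<in> edges G} \<le> p"
    using S by (auto simp: p_independent_iff[OF finS])
  have deg: "card {u \<in> verts G. {v, u} \<in> edges G} = r" if "v \<in> verts G" for v
    using that reg by (auto simp: regular_def degree_def adjacent_def)
  define N where "N v = {t \<in> verts G - S. {v, t} \<in> edges G}" for v
  have N_ge: "r - p \<le> card (N v)" if "v \<in> S" for v
  proof -
    have "{u \<in> verts G. {v, u} \<in> edges G} = N v \<union> {u \<in> S. {v, u} \<in> edges G}"
      using SV by (auto simp: N_def)
    then have "r \<le> card (N v) + card {u \<in> S. {v, u} \<in> edges G}"
      using deg[of v] that SV card_Un_le[of "N v" "{u \<in> S. {v, u} \<in> edges G}"] by auto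
    then show ?thesis using Sdeg[OF that] by simp
  qed
  have finN: "finite (N v)" for v using finV by (simp add: N_def)
  \<comment> \<open>Pairing with \<open>{..p}\<close> makes \<open>p + 1\<close> copies of each
    outside neighbour, so an injective choice uses each neighbour at most \<open>p + 1\<close>
    times.\<close>
  have "\<exists>f. inj_on f S \<and> (\<forall>v\<in>S. f v \<in> N v \<times> {..p})"
  proof (rule hall)
    fix J assume J: "J \<subseteq> S"
    have finJ: "finite J" using J finS finite_subset by blast
    define T where "T = \<Union>(N ` J)"
    have finT: "finite T" using finJ finN by (simp add: T_def)
    \<comment> \<open>The edges between \<open>J\<close> and \<open>T\<close> are counted from both
      sides: at least \<open>r - p\<close> at each vertex of \<open>J\<close>, at most
      \<open>r\<close> at each vertex of \<open>T\<close>.\<close>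
    have "card J * (r - p) \<le> (\<Sum>v\<in>J. card (N v))"
      using J N_ge by (intro sum_bounded_below[of J "r - p", simplified]) blast
    also have "\<dots> = (\<Sum>v\<in>J. card {t \<in> T. {v, t} \<in> edges G \<and> t \<in> verts G - S})"
      by (intro sum.cong arg_cong[where f = card]) (auto simp: T_def N_def)
    also have "\<dots> = (\<Sum>t\<in>T. card {v \<in> J. {v, t} \<in> edges G \<and> t \<in> verts G - S})"
      using sum.swap_restrict[OF finJ finT, of "\<lambda>_ _. 1::nat"
          "\<lambda>v t. {v, t} \<in> edges G \<and> t \<in> verts G - S"] by simp
    also have "\<dots> \<le> (\<Sum>t\<in>T. r)"
    proof (rule sum_mono)
      fix t assume "t \<in> T"
      then have t: "t \<in> verts G" by (auto simp: T_def N_def)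
      have "card {v \<in> J. {v, t} \<in> edges G \<and> t \<in> verts G - S} \<le> card {v \<in> verts G. {t, v} \<in> edges G}"
        using J SV finV by (intro card_mono) (auto simp: insert_commute)
      then show "card {v \<in> J. {v, t} \<in> edges G \<and> t \<in> verts G - S} \<le> r" using deg[OF t] by simp
    qed
    also have "\<dots> = card T * r" by simp
    also have "\<dots> \<le> card T * ((p + 1) * (r - p))"
    proof -
      \<comment> \<open>Since \<open>r - p\<close> is at least 1, \<open>r = p + (r - p)\<close> is
        at most \<open>p * (r - p) + (r - p)\<close>.\<close>
      have "p * 1 \<le> p * (r - p)" using p by (intro mult_le_mono2) simp
      then have "r \<le> p * (r - p) + (r - p)" using p by linarith
      then have "r \<le> (p + 1) * (r - p)" by simp
      then show ?thesis by (rule mult_le_mono2)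
    qed
    finally have "card J * (r - p) \<le> card T * (p + 1) * (r - p)" by (simp only: mult.assoc)
    then have "card J \<le> card T * (p + 1)" using p by (simp only: mult_le_cancel2)
    also have "\<dots> = card (T \<times> {..p})" by (simp add: card_cartesian_product)
    also have "T \<times> {..p} = (\<Union>v\<in>J. N v \<times> {..p})" by (auto simp: T_def)
    finally show "card J \<le> card (\<Union>v\<in>J. N v \<times> {..p})" .
  qed (use finS finN in auto)
  then obtain f where inj: "inj_on f S" and f: "\<And>v. v \<in> S \<Longrightarrow> f v \<in> N v \<times> {..p}" by blast
  define t where "t v = fst (f v)" for v
  have t: "t v \<notin> S" "{v, t v} \<in> edges G" if "v \<in> S" for v
    using f[OF that] by (auto simp: t_def N_def)
  \<comment> \<open>A single edge; the edges with a common value of \<open>t\<close> form a star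
    centred at that vertex outside \<open>S\<close>.\<close>
  define star where "star v = {v, t v}" for v
  have star_inj: "inj_on star S"
    using t by (auto simp: inj_on_def star_def doubleton_eq_iff)
  have "p_independent p (line_graph G) (star ` S)"
  proof (rule p_independent_line_graph)
    fix e assume "e \<in> star ` S"
    then obtain v where v: "v \<in> S" "e = star v" by blast
    define W where "W = {w \<in> S. t w = t v}"
    have finW: "finite W" using finS by (simp add: W_def)
    \<comment> \<open>On \<open>W\<close> the injection \<open>f\<close> takes values among the
      \<open>p + 1\<close> copies of the one centre \<open>t v\<close>.\<close>
    have "card W \<le> card ({t v} \<times> {..p})"
    proof (rule card_inj_on_le)
      show "inj_on f W" using inj by (rule inj_on_subset) (auto simp: W_def)
      show "f ` W \<subseteq> {t v} \<times> {..p}" using f by (fastforce simp: W_def t_def mem_Times_iff)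
    qed simp
    then have "card W \<le> p + 1" by (simp add: card_cartesian_product)
    then have Wv: "card (W - {v}) \<le> p" using v finW by (simp add: W_def)
    \<comment> \<open>Each chosen edge has exactly one end in \<open>S\<close>, and these ends
      differ for distinct edges, so two chosen edges can meet only at a common centre.\<close>
    have "{g \<in> star ` S. g \<noteq> e \<and> e \<inter> g \<noteq> {}} \<subseteq> star ` (W - {v})"
      using v t by (auto simp: star_def W_def)
    then have "card {g \<in> star ` S. g \<noteq> e \<and> e \<inter> g \<noteq> {}} \<le> card (W - {v})"
      using finW by (meson card_image_le card_mono finite_Diff finite_imageI le_trans)
    then show "card {g \<in> star ` S. g \<noteq> e \<and> e \<inter> g \<noteq> {}} \<le> p" using Wv by simp
  qed (use finS t in \<open>auto simp: star_def\<close>)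
  then have "card (star ` S) \<le> alpha p (line_graph G)"
    using finite_edges[OF G] by (intro card_le_alpha) (auto simp: line_graph_def)
  then show ?thesis using card_image[OF star_inj] by simp
qed

theorem theorem2:
  fixes G :: "'a graph" and r p :: nat
  assumes "finite_simple_graph G" and "regular r G" and "r \<ge> 2"
  shows "alpha p G \<le> alpha p (line_graph G)"
proof -
  have finV: "finite (verts G)" using assms by (simp add: finite_simple_graph_def)
  obtain S where S: "p_independent p G S" "card S = alpha p G"
    using alpha_attained[OF finV] by blast
  show ?thesis
  proof (cases "p < r")
    case True
    then show ?thesis
      using card_p_independent_le_alpha_line_graph[OF assms(1,2)] S by metis
  next
    case False
    have "card S \<le> card (verts G)" using S finV by (intro card_mono) (auto simp: p_independent_def)
    also have "\<dots> \<le> alpha p (line_graph G)"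
      using card_verts_le_alpha_line_graph[OF assms] False by simp
    finally show ?thesis using S by simp
  qed
qed

end
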